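(* There exist constants $C>0$ and $m_0$ such that for every integer $m\ge m_0$ and all sufficiently large $n$ the following holds: for every instance of $n$ independent identically distributed continuous random variables $X_1,\dots,X_n$, there is an algorithm in the oracle model with $m$ oracle calls that selects the maximum realization $\max_i X_i$ with probability at least $1-C\,m^{-m/5}$.
   Context: Oracle model with $m$ calls: the common distribution of $X_1,\dots,X_n$ is known to the algorithm; realizations are revealed one at a time in the order $X_1,\dots,X_n$, and the algorithm may select at most one value, irrevocably at the time it is observed. At most $m$ times, after observing the current realization $X_i$ and before deciding on it, it may query an oracle, which answers YES if $X_i>\max_{j=i+1}^n X_j$ and NO otherwise. "Sufficiently large $n$" may depend on $m$. *)

theory Defs
  imports "HOL-Probability.Probability"
begin

text \<open>
  A (deterministic) algorithm in the oracle model. When the \<open>i\<close>-th value is revealed, \<open>query\<close>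
  receives the values \<open>X\<^sub>1, \<dots>, X\<^sub>i\<close> and the oracle record of the steps \<open>1, \<dots>, i - 1\<close>, and
  \<open>accept\<close> receives the values \<open>X\<^sub>1, \<dots>, X\<^sub>i\<close> and the oracle record of the steps \<open>1, \<dots>, i\<close>.
  The entry of a record for a step is \<open>None\<close> if the oracle was not queried at that step, and
  \<open>Some b\<close> if it was queried and answered \<open>b\<close>. Receiving only these lists makes an algorithm
  unable to look ahead.
\<close>

record oracle_algorithm =
  query :: "real list \<Rightarrow> bool option list \<Rightarrow> bool"
  accept :: "real list \<Rightarrow> bool option list \<Rightarrow> bool"

definition observed :: "(nat \<Rightarrow> real) \<Rightarrow> nat \<Rightarrow> real list" where
  "observed x i = map x [1..<Suc i]"

text \<open>At \<open>i = n\<close> the maximum is over the empty set, read as \<open>-\<infinity>\<close>, so the answer is YES.\<close>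

definition oracle_answer :: "nat \<Rightarrow> (nat \<Rightarrow> real) \<Rightarrow> nat \<Rightarrow> bool" where
  "oracle_answer n x i \<longleftrightarrow> (\<forall>j\<in>{i<..n}. x j < x i)"

text \<open>
  The record and \<open>accepts_at\<close> are defined as if the run continued past the first acceptance;
  only \<open>reaches\<close> takes into account that the run ends there.
\<close>

primrec oracle_record :: "nat \<Rightarrow> oracle_algorithm \<Rightarrow> (nat \<Rightarrow> real) \<Rightarrow> nat \<Rightarrow> bool option list" where
  "oracle_record n A x 0 = []"
| "oracle_record n A x (Suc i) =
     oracle_record n A x i @
       [if query A (observed x (Suc i)) (oracle_record n A x i)
        then Some (oracle_answer n x (Suc i)) else None]"

definition accepts_at :: "nat \<Rightarrow> oracle_algorithm \<Rightarrow> (nat \<Rightarrow> real) \<Rightarrow> nat \<Rightarrow> bool" where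
  "accepts_at n A x i \<longleftrightarrow> accept A (observed x i) (oracle_record n A x i)"

definition reaches :: "nat \<Rightarrow> oracle_algorithm \<Rightarrow> (nat \<Rightarrow> real) \<Rightarrow> nat \<Rightarrow> bool" where
  "reaches n A x i \<longleftrightarrow> i \<in> {1..n} \<and> (\<forall>j\<in>{1..<i}. \<not> accepts_at n A x j)"

definition oracle_calls :: "nat \<Rightarrow> oracle_algorithm \<Rightarrow> (nat \<Rightarrow> real) \<Rightarrow> nat set" where
  "oracle_calls n A x =
     {i. reaches n A x i \<and> query A (observed x i) (oracle_record n A x (i - 1))}"

definition selects :: "nat \<Rightarrow> oracle_algorithm \<Rightarrow> (nat \<Rightarrow> real) \<Rightarrow> nat \<Rightarrow> bool" where
  "selects n A x i \<longleftrightarrow> reaches n A x i \<and> accepts_at n A x i"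

definition selects_max :: "nat \<Rightarrow> oracle_algorithm \<Rightarrow> (nat \<Rightarrow> real) \<Rightarrow> bool" where
  "selects_max n A x \<longleftrightarrow> (\<exists>i. selects n A x i \<and> x i = Max (x ` {1..n}))"

text \<open>The decisions at step \<open>i\<close> are Borel functions of the first \<open>i\<close> values, for each record.\<close>

definition measurable_algorithm :: "nat \<Rightarrow> oracle_algorithm \<Rightarrow> bool" where
  "measurable_algorithm n A \<longleftrightarrow>
     (\<forall>i\<in>{1..n}.
        (\<forall>as. length as = i - 1 \<longrightarrow>
           Measurable.pred (\<Pi>\<^sub>M j\<in>{1..i}. borel) (\<lambda>x. query A (observed x i) as)) \<and>
        (\<forall>as. length as = i \<longrightarrow>
           Measurable.pred (\<Pi>\<^sub>M j\<in>{1..i}. borel) (\<lambda>x. accept A (observed x i) as)))"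

definition algorithm_with_calls :: "nat \<Rightarrow> nat \<Rightarrow> oracle_algorithm \<Rightarrow> bool" where
  "algorithm_with_calls m n A \<longleftrightarrow>
     measurable_algorithm n A \<and> (\<forall>x. card (oracle_calls n A x) \<le> m)"

text \<open>
  The probability that \<open>A\<close> selects the maximum of \<open>n\<close> independent values with law \<open>D\<close>, whose joint
  law is the product measure; \<open>success_probability_iid\<close> below gives the version for random
  variables on an arbitrary probability space.
\<close>

definition success_probability :: "real measure \<Rightarrow> nat \<Rightarrow> oracle_algorithm \<Rightarrow> real" where
  "success_probability D n A =
     measure (\<Pi>\<^sub>M i\<in>{1..n}. D) {x \<in> space (\<Pi>\<^sub>M i\<in>{1..n}. D). selects_max n A x}"

definition continuous_distribution :: "real measure \<Rightarrow> bool" where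
  "continuous_distribution D \<longleftrightarrow> real_distribution D \<and> continuous_on UNIV (cdf D)"

lemma finite_oracle_calls: "finite (oracle_calls n A x)"
  by (rule finite_subset[of _ "{1..n}"]) (auto simp: oracle_calls_def reaches_def)

lemma length_oracle_record [simp]: "length (oracle_record n A x i) = i"
  by (induction i) auto

lemma pred_restrict_observed:
  assumes "i \<in> {1..n}"
    and "Measurable.pred (\<Pi>\<^sub>M j\<in>{1..i}. borel) (\<lambda>x. P (observed x i))"
  shows "Measurable.pred (\<Pi>\<^sub>M j\<in>{1..n}. borel) (\<lambda>x. P (observed x i))"
proof -
  have "Measurable.pred (\<Pi>\<^sub>M j\<in>{1..n}. borel) (\<lambda>x. P (observed (restrict x {1..i}) i))"
    by (rule measurable_compose[OF measurable_restrict_subset assms(2)]) (use assms(1) in auto)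
  moreover have "observed (restrict x {1..i}) i = observed x i" for x
    by (auto simp: observed_def)
  ultimately show ?thesis by simp
qed

lemma pred_with_record:
  assumes "i \<in> {1..n}"
    and rec: "(\<lambda>x. oracle_record n A x k) \<in> (\<Pi>\<^sub>M j\<in>{1..n}. borel) \<rightarrow>\<^sub>M count_space UNIV"
    and P: "\<And>as. length as = k \<Longrightarrow>
           Measurable.pred (\<Pi>\<^sub>M j\<in>{1..i}. borel) (\<lambda>x. P (observed x i) as)"
  shows "Measurable.pred (\<Pi>\<^sub>M j\<in>{1..n}. borel) (\<lambda>x. P (observed x i) (oracle_record n A x k))"
proof -
  have "Measurable.pred (\<Pi>\<^sub>M j\<in>{1..n}. borel) (\<lambda>x. length as = k \<and> P (observed x i) as)" for as
  proof (cases "length as = k")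
    case True
    show ?thesis
      using pred_restrict_observed[where P="\<lambda>v. P v as", OF assms(1) P[OF True]] True
      by (simp only: simp_thms)
  qed simp
  from measurable_compose_countable
      [where f="\<lambda>as x. length as = k \<and> P (observed x i) as", OF this rec]
  show ?thesis by simp
qed

lemma measurable_oracle_record:
  assumes A: "measurable_algorithm n A"
  shows "i \<le> n \<Longrightarrow>
    (\<lambda>x. oracle_record n A x i) \<in> (\<Pi>\<^sub>M j\<in>{1..n}. borel) \<rightarrow>\<^sub>M count_space UNIV"
proof (induction i)
  case 0
  then show ?case by simp
next
  case (Suc i)
  let ?M = "\<Pi>\<^sub>M j\<in>{1..n}. (borel :: real measure)"
  have rec: "(\<lambda>x. oracle_record n A x i) \<in> ?M \<rightarrow>\<^sub>M count_space UNIV"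
    using Suc by simp
  have qry:
    "Measurable.pred ?M (\<lambda>x. query A (observed x (Suc i)) (oracle_record n A x i))"
  proof (rule pred_with_record[OF _ rec])
    show "Suc i \<in> {1..n}"
      using Suc.prems by simp
    with A show "Measurable.pred (\<Pi>\<^sub>M j\<in>{1..Suc i}. borel) (\<lambda>x. query A (observed x (Suc i)) as)"
      if "length as = i" for as
      using that unfolding measurable_algorithm_def by (metis diff_Suc_1)
  qed
  have comp: "(\<lambda>x. x j) \<in> borel_measurable ?M" if "j \<in> {1..n}" for j
    using that by measurable
  have ans: "Measurable.pred ?M (\<lambda>x. oracle_answer n x (Suc i))"
    unfolding oracle_answer_def
  proof (rule pred_intros_finite)
    show "Measurable.pred ?M (\<lambda>x. x j < x (Suc i))" if "j \<in> {Suc i<..n}" for j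
      using that Suc.prems by (intro borel_measurable_pred_less comp) auto
  qed simp
  have "(\<lambda>x. as @ [if query A (observed x (Suc i)) (oracle_record n A x i)
      then Some (oracle_answer n x (Suc i)) else None]) \<in> ?M \<rightarrow>\<^sub>M count_space UNIV" for as
  proof -
    let ?f = "\<lambda>(b, c). as @ [if b then Some c else None]"
    have "(\<lambda>x. (query A (observed x (Suc i)) (oracle_record n A x i), oracle_answer n x (Suc i)))
        \<in> ?M \<rightarrow>\<^sub>M count_space UNIV \<Otimes>\<^sub>M count_space UNIV"
      by (rule measurable_Pair[OF qry ans])
    also have "count_space UNIV \<Otimes>\<^sub>M count_space UNIV = (count_space UNIV :: (bool \<times> bool) measure)"
      by (subst pair_measure_countable) auto
    finally have "(\<lambda>x. ?f (query A (observed x (Suc i)) (oracle_record n A x i),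
        oracle_answer n x (Suc i))) \<in> ?M \<rightarrow>\<^sub>M count_space UNIV"
      by (rule measurable_compose) simp
    then show ?thesis by simp
  qed
  from measurable_compose_countable[OF this rec] show ?case by simp
qed

lemma measurable_selects_max:
  assumes A: "measurable_algorithm n A"
  shows "Measurable.pred (\<Pi>\<^sub>M j\<in>{1..n}. borel) (selects_max n A)"
proof -
  let ?M = "\<Pi>\<^sub>M j\<in>{1..n}. (borel :: real measure)"
  have acc: "Measurable.pred ?M (\<lambda>x. accepts_at n A x i)" if "i \<in> {1..n}" for i
    unfolding accepts_at_def
  proof (rule pred_with_record[OF that measurable_oracle_record[OF A]])
    show "i \<le> n"
      using that by simp
    show "Measurable.pred (\<Pi>\<^sub>M j\<in>{1..i}. borel) (\<lambda>x. accept A (observed x i) as)"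
      if "length as = i" for as
      using A \<open>i \<in> {1..n}\<close> that unfolding measurable_algorithm_def by blast
  qed
  have comp: "(\<lambda>x. x j) \<in> borel_measurable ?M" if "j \<in> {1..n}" for j
    using that by measurable
  have "selects_max n A x \<longleftrightarrow> (\<exists>i\<in>{1..n}. (\<forall>j\<in>{1..<i}. \<not> accepts_at n A x j) \<and>
      accepts_at n A x i \<and> (\<forall>j\<in>{1..n}. x j \<le> x i))" for x
  proof -
    have "x i = Max (x ` {1..n}) \<longleftrightarrow> (\<forall>j\<in>{1..n}. x j \<le> x i)" if "i \<in> {1..n}" for i
      using that by (subst eq_Max_iff) auto
    then show ?thesis
      by (auto simp: selects_max_def selects_def reaches_def)
  qed
  then have eq: "selects_max n A = (\<lambda>x. \<exists>i\<in>{1..n}. (\<forall>j\<in>{1..<i}. \<not> accepts_at n A x j) \<and>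
      accepts_at n A x i \<and> (\<forall>j\<in>{1..n}. x j \<le> x i))"
    by (intro ext)
  show ?thesis
    unfolding eq
  proof (intro pred_intros_finite pred_intros_logic acc)
    show "Measurable.pred ?M (\<lambda>x. x j \<le> x i)" if "j \<in> {1..n}" "i \<in> {1..n}" for i j
      unfolding pred_def using comp[OF that(1)] comp[OF that(2)] by (rule borel_measurable_le)
  qed auto
qed

lemma selects_max_restrict:
  "selects_max n A (restrict x {1..n}) \<longleftrightarrow> selects_max n A x"
proof -
  have o: "observed (restrict x {1..n}) i = observed x i" if "i \<le> n" for i
    using that by (auto simp: observed_def)
  have r: "oracle_record n A (restrict x {1..n}) i = oracle_record n A x i" if "i \<le> n" for i
    using that
  proof (induction i)
    case (Suc i)
    have "oracle_answer n (restrict x {1..n}) (Suc i) = oracle_answer n x (Suc i)"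
      using Suc.prems by (simp add: oracle_answer_def)
    moreover have "oracle_record n A (restrict x {1..n}) i = oracle_record n A x i"
      using Suc.IH Suc.prems by (meson Suc_leD)
    ultimately show ?case
      by (simp only: oracle_record.simps o[OF Suc.prems])
  qed simp
  have "selects n A (restrict x {1..n}) i \<longleftrightarrow> selects n A x i" for i
    using o r by (auto simp: selects_def reaches_def accepts_at_def)
  moreover have "restrict x {1..n} ` {1..n} = x ` {1..n}"
    by auto
  ultimately show ?thesis
    by (auto simp: selects_max_def selects_def reaches_def)
qed

lemma success_probability_iid:
  assumes "prob_space M" "n \<ge> 1"
    and indep: "prob_space.indep_vars M (\<lambda>_. borel) X {1..n}"
    and ident: "\<And>i. i \<in> {1..n} \<Longrightarrow> distr M borel (X i) = D"
    and A: "measurable_algorithm n A"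
  shows "success_probability D n A = measure M {\<omega> \<in> space M. selects_max n A (\<lambda>i. X i \<omega>)}"
proof -
  interpret prob_space M by fact
  let ?B = "\<Pi>\<^sub>M j\<in>{1..n}. (borel :: real measure)"
  let ?Y = "\<lambda>\<omega>. \<lambda>i\<in>{1..n}. X i \<omega>"
  have rv: "\<And>i. i \<in> {1..n} \<Longrightarrow> X i \<in> borel_measurable M"
    using indep by (auto simp: indep_vars_def)
  have Y: "?Y \<in> M \<rightarrow>\<^sub>M ?B"
    using rv by (intro measurable_restrict) auto
  have "distr M ?B ?Y = (\<Pi>\<^sub>M i\<in>{1..n}. distr M borel (X i))"
    using indep rv \<open>n \<ge> 1\<close> indep_vars_iff_distr_eq_PiM'[of "{1..n}" X "\<lambda>_. borel"] by simp
  also have "\<dots> = (\<Pi>\<^sub>M i\<in>{1..n}. D)"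
    by (intro PiM_cong refl ident)
  finally have D: "(\<Pi>\<^sub>M i\<in>{1..n}. D) = distr M ?B ?Y" ..
  have "{x \<in> space ?B. selects_max n A x} \<in> sets ?B"
    using measurable_selects_max[OF A] by (simp add: pred_def)
  moreover have "?Y -` {x \<in> space ?B. selects_max n A x} \<inter> space M =
      {\<omega> \<in> space M. selects_max n A (\<lambda>i. X i \<omega>)}"
    using selects_max_restrict[of n A] measurable_space[OF Y] by blast
  ultimately show ?thesis
    unfolding success_probability_def D by (simp only: measure_distr[OF Y] space_distr)
qed

end

theory Submission
  imports Defs "HOL-Real_Asymp.Real_Asymp"
begin

text \<open>
  Fix a threshold \<open>t\<close> that a value exceeds with probability \<open>L / n\<close>, where \<open>L = (m / 5) ln m\<close>, query
  the oracle at every record of height at least \<open>t\<close>, and accept as soon as it says YES. This fails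
  only if no value reaches \<open>t\<close>, which has probability \<open>(1 - L / n)\<^sup>n \<le> m powr (- m / 5)\<close>, or if more
  than \<open>m\<close> records reach \<open>t\<close>. About \<open>ln L\<close> such records are expected; their number \<open>R\<close> satisfies
  \<open>E z\<^sup>R \<le> (1 + L)\<^sup>z\<close> for every integer \<open>z \<ge> 1\<close>, so Markov's inequality with \<open>z\<close> about \<open>\<surd>m\<close>
  makes the second probability at most \<open>m powr (- m / 5)\<close> as well.
\<close>

section \<open>Running maxima and records above a threshold\<close>

text \<open>Starting the recursion at the threshold lets one comparison test both for being a record
  and for reaching height \<open>t\<close>.\<close>

primrec running_max :: "real \<Rightarrow> (nat \<Rightarrow> real) \<Rightarrow> nat \<Rightarrow> real" where
  "running_max t x 0 = t"
| "running_max t x (Suc i) = max (running_max t x i) (x (Suc i))"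

definition record_at :: "real \<Rightarrow> (nat \<Rightarrow> real) \<Rightarrow> nat \<Rightarrow> bool" where
  "record_at t x i \<longleftrightarrow> running_max t x (i - 1) \<le> x i"

definition record_count :: "real \<Rightarrow> (nat \<Rightarrow> real) \<Rightarrow> nat \<Rightarrow> nat" where
  "record_count t x i = card {j \<in> {1..i}. record_at t x j}"

text \<open>This and the two congruences for records make the notions at step \<open>i\<close>
  functions of the first \<open>i\<close> values: the algorithm can evaluate them on its observed
  list, and a later coordinate can be changed without affecting them.\<close>

lemma running_max_cong:
  "(\<And>j. j \<in> {1..i} \<Longrightarrow> x j = y j) \<Longrightarrow> running_max t x i = running_max t y i"
  by (induction i) auto

lemma running_max_le_iff: "running_max t x i \<le> b \<longleftrightarrow> t \<le> b \<and> (\<forall>j\<in>{1..i}. x j \<le> b)"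
  by (induction i) (auto simp: le_Suc_eq)

lemma record_at_cong:
  assumes "\<And>j. j \<in> {1..i} \<Longrightarrow> x j = y j" "1 \<le> i"
  shows "record_at t x i = record_at t y i"
proof -
  have "running_max t x (i - 1) = running_max t y (i - 1)"
    using assms(1) by (rule running_max_cong) auto
  then show ?thesis using assms by (simp add: record_at_def)
qed

lemma record_count_cong:
  assumes "\<And>j. j \<in> {1..i} \<Longrightarrow> x j = y j"
  shows "record_count t x i = record_count t y i"
proof -
  have "record_at t x j = record_at t y j" if "j \<in> {1..i}" for j
    using that assms by (intro record_at_cong) auto
  then show ?thesis
    unfolding record_count_def by (intro arg_cong[of _ _ card]) auto
qed

lemma record_count_0 [simp]: "record_count t x 0 = 0"
  by (simp add: record_count_def)

lemma record_count_Suc: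
  "record_count t x (Suc i) =
     record_count t x i + (if running_max t x i \<le> x (Suc i) then 1 else 0)"
proof -
  have "{j \<in> {1..Suc i}. record_at t x j} =
      (if record_at t x (Suc i) then insert (Suc i) else id) {j \<in> {1..i}. record_at t x j}"
    by (auto simp: le_Suc_eq)
  then show ?thesis
    by (auto simp: record_count_def record_at_def)
qed

lemma record_count_mono: "i \<le> k \<Longrightarrow> record_count t x i \<le> record_count t x k"
  by (rule lift_Suc_mono_le[of "record_count t x"]) (simp_all add: record_count_Suc)

lemma measurable_running_max:
  "{1..i} \<subseteq> I \<Longrightarrow> (\<lambda>x. running_max t x i) \<in> borel_measurable (\<Pi>\<^sub>M j\<in>I. borel)"
proof (induction i)
  case (Suc i)
  then have "(\<lambda>x. x (Suc i)) \<in> borel_measurable (\<Pi>\<^sub>M j\<in>I. (borel :: real measure))"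
    by (intro measurable_component_singleton) auto
  moreover have "(\<lambda>x. running_max t x i) \<in> borel_measurable (\<Pi>\<^sub>M j\<in>I. borel)"
    by (intro Suc.IH order_trans[OF _ Suc.prems]) auto
  ultimately show ?case by simp
qed simp

lemma measurable_record_at:
  assumes "{1..i} \<subseteq> I" "1 \<le> i"
  shows "Measurable.pred (\<Pi>\<^sub>M j\<in>I. borel) (\<lambda>x. record_at t x i)"
proof -
  have "(\<lambda>x. x i) \<in> borel_measurable (\<Pi>\<^sub>M j\<in>I. (borel :: real measure))"
    using assms by (intro measurable_component_singleton) auto
  moreover have "(\<lambda>x. running_max t x (i - 1)) \<in> borel_measurable (\<Pi>\<^sub>M j\<in>I. borel)"
    by (intro measurable_running_max order_trans[OF _ assms(1)]) auto
  ultimately show ?thesis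
    unfolding record_at_def pred_def by (intro borel_measurable_le)
qed

lemma measurable_record_count:
  "{1..i} \<subseteq> I \<Longrightarrow> (\<lambda>x. record_count t x i) \<in> (\<Pi>\<^sub>M j\<in>I. borel) \<rightarrow>\<^sub>M count_space UNIV"
proof (induction i)
  case (Suc i)
  have [measurable]: "Measurable.pred (\<Pi>\<^sub>M j\<in>I. borel) (\<lambda>x. running_max t x i \<le> x (Suc i))"
    using measurable_record_at[OF Suc.prems, of t] by (simp add: record_at_def)
  have [measurable]: "(\<lambda>x. record_count t x i) \<in> (\<Pi>\<^sub>M j\<in>I. borel) \<rightarrow>\<^sub>M count_space UNIV"
    by (intro Suc.IH order_trans[OF _ Suc.prems]) auto
  show ?case unfolding record_count_Suc by measurable
qed simp

section \<open>The algorithm that queries at records\<close>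

text \<open>Observed lists are indexed from 0 and values from 1, hence the shift. The test
  \<open>record_count \<le> m\<close> enforces the budget. The last entry of \<open>as\<close>
  belongs to the current step, so acceptance means that the oracle was queried just now and said
  YES.\<close>

definition record_algorithm :: "nat \<Rightarrow> real \<Rightarrow> oracle_algorithm" where
  "record_algorithm m t =
     \<lparr>query = (\<lambda>xs as. let x = (\<lambda>j. xs ! (j - 1)) in
        record_at t x (length xs) \<and> record_count t x (length xs) \<le> m),
      accept = (\<lambda>xs as. last as = Some True)\<rparr>"

lemma query_record_algorithm:
  assumes "1 \<le> i"
  shows "query (record_algorithm m t) (observed x i) as \<longleftrightarrow>
    record_at t x i \<and> record_count t x i \<le> m"
proof -
  have eq: "observed x i ! (j - 1) = x j" if "j \<in> {1..i}" for j
    using that by (auto simp: observed_def simp del: upt_Suc)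
  have "length (observed x i) = i"
    by (simp add: observed_def)
  then show ?thesis
    using record_at_cong[OF eq assms, where t=t] record_count_cong[OF eq, where t=t]
    by (simp add: record_algorithm_def Let_def)
qed

lemma accepts_at_record_algorithm:
  assumes "1 \<le> i"
  shows "accepts_at n (record_algorithm m t) x i \<longleftrightarrow>
    record_at t x i \<and> record_count t x i \<le> m \<and> oracle_answer n x i"
proof -
  obtain k where k: "i = Suc k" using assms by (cases i) auto
  have "accept (record_algorithm m t) xs as \<longleftrightarrow> last as = Some True" for xs as
    by (simp add: record_algorithm_def)
  then show ?thesis
    unfolding accepts_at_def k
    by (simp only: oracle_record.simps query_record_algorithm[of "Suc k"] last_snoc) auto
qed

lemma record_algorithm_with_calls: "algorithm_with_calls m n (record_algorithm m t)"
  unfolding algorithm_with_calls_def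
proof
  show "measurable_algorithm n (record_algorithm m t)"
    unfolding measurable_algorithm_def
  proof (intro ballI conjI allI impI)
    fix i as assume i: "i \<in> {1..n}"
    have [measurable]: "Measurable.pred (\<Pi>\<^sub>M j\<in>{1..i}. borel) (\<lambda>x. record_at t x i)"
      "(\<lambda>x. record_count t x i) \<in> (\<Pi>\<^sub>M j\<in>{1..i}. borel) \<rightarrow>\<^sub>M count_space UNIV"
      using i by (auto intro: measurable_record_at measurable_record_count)
    have "Measurable.pred (\<Pi>\<^sub>M j\<in>{1..i}. borel) (\<lambda>x. record_at t x i \<and> record_count t x i \<le> m)"
      by measurable
    then show "Measurable.pred (\<Pi>\<^sub>M j\<in>{1..i}. borel)
        (\<lambda>x. query (record_algorithm m t) (observed x i) as)"
      using i by (simp add: query_record_algorithm)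
  qed (simp add: record_algorithm_def)
  show "\<forall>x. card (oracle_calls n (record_algorithm m t) x) \<le> m"
  proof
    fix x
    define S where "S = {i \<in> {1..n}. record_at t x i \<and> record_count t x i \<le> m}"
    have "oracle_calls n (record_algorithm m t) x \<subseteq> S"
      by (auto simp: oracle_calls_def reaches_def S_def query_record_algorithm)
    moreover have "finite S" by (simp add: S_def)
    moreover have "card S \<le> m"
    proof (cases "S = {}")
      case False
      \<comment> \<open>All elements of \<open>S\<close> are records up to its last element
        \<open>k\<close>, and the budget test held at \<open>k\<close>.\<close>
      define k where "k = Max S"
      have "k \<in> S" using False \<open>finite S\<close> by (simp add: k_def)
      have "card S \<le> record_count t x k"
        unfolding record_count_def
        using \<open>finite S\<close> by (intro card_mono) (auto simp: S_def k_def)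
      then show ?thesis using \<open>k \<in> S\<close> by (simp add: S_def)
    qed simp
    ultimately show "card (oracle_calls n (record_algorithm m t) x) \<le> m"
      by (meson card_mono le_trans)
  qed
qed

text \<open>
  Records are weak and the oracle answers strictly, so in case of ties the last maximal index is
  the one that is selected.
\<close>

lemma record_algorithm_selects_max:
  assumes "i \<in> {1..n}" "t \<le> x i" and count: "record_count t x n \<le> m"
  shows "selects_max n (record_algorithm m t) x"
proof -
  define mx where "mx = Max (x ` {1..n})"
  define s where "s = Max {j \<in> {1..n}. x j = mx}"
  have "mx \<in> x ` {1..n}" unfolding mx_def using assms by (intro Max_in) auto
  then have "{j \<in> {1..n}. x j = mx} \<noteq> {}" by auto
  then have "s \<in> {j \<in> {1..n}. x j = mx}" unfolding s_def by (intro Max_in) auto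
  then have s: "s \<in> {1..n}" "x s = mx" by auto
  have le: "x j \<le> mx" if "j \<in> {1..n}" for j using that by (simp add: mx_def)
  have "x j < mx" if "j \<in> {s<..n}" for j
  proof -
    have "x j \<noteq> mx"
    proof
      assume "x j = mx"
      then have "j \<le> s" unfolding s_def using that s by (intro Max_ge) auto
      then show False using that by simp
    qed
    then show ?thesis using le[of j] that s by auto
  qed
  then have ans: "oracle_answer n x s" by (auto simp: oracle_answer_def s)
  have "record_at t x s"
    using le assms s order_trans[OF assms(2) le[OF assms(1)]]
    by (auto simp: record_at_def running_max_le_iff)
  moreover have "record_count t x s \<le> m"
    using record_count_mono[of s n t x] s count by simp
  ultimately have "accepts_at n (record_algorithm m t) x s"
    using ans s by (simp add: accepts_at_record_algorithm)
  \<comment> \<open>The run does not end before \<open>s\<close>: there \<open>x s\<close> is still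
    to come and is at least \<open>x j\<close>, so the answer is NO.\<close>
  moreover have "\<not> accepts_at n (record_algorithm m t) x j" if j: "j \<in> {1..<s}" for j
  proof -
    have "\<not> oracle_answer n x j"
      using le[of j] j s by (auto simp: oracle_answer_def intro!: bexI[of _ s])
    then show ?thesis using j by (simp add: accepts_at_record_algorithm)
  qed
  ultimately show ?thesis
    using s by (auto simp: selects_max_def selects_def reaches_def mx_def)
qed

section \<open>Continuous distributions and the probability integral transform\<close>

locale continuous_real_distribution = real_distribution D for D :: "real measure" +
  assumes continuous_cdf: "continuous_on UNIV (cdf D)"
begin

lemma cdf_attains:
  assumes "0 < u" "u < 1"
  obtains t where "cdf D t = u"
proof -
  have "eventually (\<lambda>x. cdf D x < u) at_bot"
    using order_tendstoD(2)[OF cdf_lim_at_bot assms(1)] .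
  then obtain a where a: "cdf D a < u"
    using eventually_happens'[OF trivial_limit_at_bot_linorder] by blast
  have "eventually (\<lambda>x. u < cdf D x) at_top"
    using order_tendstoD(1)[OF cdf_lim_at_top_prob assms(2)] .
  then obtain b where b: "u < cdf D b"
    using eventually_happens'[OF trivial_limit_at_top_linorder] by blast
  have "a \<le> b"
    using cdf_nondecreasing[of b a] a b by linarith
  then obtain t where "cdf D t = u"
    using IVT'[of "cdf D" a u b] a b continuous_on_subset[OF continuous_cdf] by auto
  then show ?thesis by (rule that)
qed

text \<open>Probability integral transform. The cdf may have flat pieces and so no inverse; both
  bounds use points where nearby levels are attained, followed by a limit.\<close>

lemma prob_cdf_le:
  assumes "0 \<le> u" "u \<le> 1"
  shows "\<P>(x in D. cdf D x \<le> u) = u"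
proof (rule antisym)
  have [measurable]: "cdf D \<in> borel_measurable borel"
    using continuous_cdf by (rule borel_measurable_continuous_onI)
  have meas: "{x \<in> space D. cdf D x \<le> v} \<in> sets D" for v
    by measurable
  have upper: "\<P>(x in D. cdf D x \<le> v) \<le> w" if vw: "v < w" "0 \<le> v" "w < 1" for v w
  proof -
    obtain t where t: "cdf D t = w" using vw by (auto intro: cdf_attains[of w])
    have "{x \<in> space D. cdf D x \<le> v} \<subseteq> {..t}"
    proof
      fix x assume "x \<in> {x \<in> space D. cdf D x \<le> v}"
      then have "\<not> cdf D t \<le> cdf D x" using t vw by simp
      then show "x \<in> {..t}" using cdf_nondecreasing[of t x] by (cases "x \<le> t") auto
    qed
    then have "\<P>(x in D. cdf D x \<le> v) \<le> cdf D t"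
      unfolding cdf_def by (intro finite_measure_mono) auto
    then show ?thesis using t by simp
  qed
  show "\<P>(x in D. cdf D x \<le> u) \<le> u"
  proof (cases "u < 1")
    case True
    then show ?thesis
      using upper[of u] assms dense_le_bounded[of u 1] by (intro dense_ge_bounded[of u 1]) auto
  next
    case False
    then show ?thesis using prob_le_1 assms by (metis order.strict_iff_order)
  qed
  show "u \<le> \<P>(x in D. cdf D x \<le> u)"
  \<comment> \<open>The lower end -1 keeps the interval below \<open>u\<close> nonempty when
    \<open>u = 0\<close>; nonpositive levels \<open>w\<close> are trivial.\<close>
  proof (rule dense_le_bounded[of "-1"])
    show "-1 < u" using assms by simp
    fix w assume w: "-1 < w" "w < u"
    show "w \<le> \<P>(x in D. cdf D x \<le> u)"
    proof (cases "w \<le> 0")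
      case False
      then obtain t where t: "cdf D t = w" using w assms by (auto intro: cdf_attains[of w])
      have "{..t} \<subseteq> {x \<in> space D. cdf D x \<le> u}"
        using cdf_nondecreasing[of _ t] t w by fastforce
      then have "cdf D t \<le> \<P>(x in D. cdf D x \<le> u)"
        unfolding cdf_def2[of D t] using meas[of u] by (rule finite_measure_mono)
      then show ?thesis using t by simp
    qed (use measure_nonneg[of D] order_trans in blast)
  qed
qed

text \<open>Moves integrals over \<open>D\<close> to Lebesgue measure on the unit interval, where
  the one-step bound reduces to the fundamental theorem of calculus.\<close>

lemma nn_integral_cdf:
  assumes [measurable]: "g \<in> borel_measurable borel"
  shows "(\<integral>\<^sup>+x. g (cdf D x) \<partial>D) = (\<integral>\<^sup>+u. g u * indicator {0..1} u \<partial>lborel)"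
proof -
  have "cdf D \<in> borel_measurable D"
    using borel_measurable_continuous_onI[OF continuous_cdf] by simp
  then have "distributed D lborel (cdf D) (\<lambda>u. indicator {0..1} u / measure lborel {0..1::real})"
    using prob_cdf_le by (intro uniform_distrI_borel_atLeastAtMost) auto
  from distributed_nn_integral[OF this, of g, symmetric] show ?thesis
    by (simp add: mult.commute ennreal_indicator)
qed

section \<open>Generating function of the number of records\<close>

text \<open>One new value \<open>y\<close> meets the running maximum \<open>M\<close>, with
  \<open>k\<close> values to come afterwards: a record earns a factor \<open>z\<close> but shrinks
  the tail probability. Substituting \<open>u = cdf D y\<close> bounds the left side by
  \<open>c * B c\<close> plus the integral of \<open>z * B\<close> over
  \<open>[c, 1]\<close>.\<close>

lemma record_step:
  fixes k z :: nat
  assumes z: "1 \<le> z"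
  shows "(\<integral>\<^sup>+y. ennreal (if M \<le> y then real z * (1 + real k * (1 - cdf D y)) ^ z
            else (1 + real k * (1 - cdf D M)) ^ z) \<partial>D)
         \<le> ennreal ((1 + real (Suc k) * (1 - cdf D M)) ^ z)"
proof -
  define c where "c = cdf D M"
  have c: "0 \<le> c" "c \<le> 1" by (auto simp: c_def cdf_nonneg cdf_bounded_prob)
  define B where "B = (\<lambda>u::real. (1 + real k * (1 - u)) ^ z)"
  \<comment> \<open>\<open>- H c\<close> is the claimed bound minus the contribution of the values below \<open>M\<close>, and \<open>H 1 = 0\<close>,
    so it suffices that \<open>H'\<close> dominates \<open>z B\<close>.\<close>
  define H where "H = (\<lambda>u::real. u * B u - (1 + real (Suc k) * (1 - u)) ^ z)"
  define H' where "H' = (\<lambda>u::real. B u - u * (real z * real k * (1 + real k * (1 - u)) ^ (z - 1))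
      + real z * real (Suc k) * (1 + real (Suc k) * (1 - u)) ^ (z - 1))"
  have [measurable]: "cdf D \<in> borel_measurable borel" "B \<in> borel_measurable borel"
      "H' \<in> borel_measurable borel"
    unfolding B_def H'_def
    using continuous_cdf by (auto intro!: borel_measurable_continuous_onI continuous_intros)
  have H: "DERIV H u :> H' u" for u
    unfolding H_def H'_def B_def by (auto intro!: derivative_eq_intros simp: algebra_simps)
  have Bnn: "0 \<le> B u" if "u \<le> 1" for u
    unfolding B_def using that
    by (intro zero_le_power add_nonneg_nonneg mult_nonneg_nonneg) auto
  have zB: "real z * B u \<le> H' u" if u: "0 \<le> u" "u \<le> 1" for u
  proof -
    define A where "A = 1 + real k * (1 - u)"
    have A: "1 \<le> A" "A + (1 - u) = 1 + real (Suc k) * (1 - u)"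
      using u by (simp_all add: A_def) (simp add: algebra_simps)
    have "B u = A ^ (z - 1) * A"
      using z by (cases z) (auto simp: B_def A_def)
    then have "real z * B u = real z * A ^ (z - 1) * (1 + real k * (1 - u))"
      by (simp add: A_def)
    \<comment> \<open>Writing \<open>1 + k * (1 - u)\<close> as \<open>(k + 1) - u * k\<close>
      produces the two power terms of \<open>H'\<close>, the second with a smaller base; the
      remaining term \<open>B u\<close> is nonnegative.\<close>
    also have "\<dots> = - (u * (real z * real k * A ^ (z - 1)))
        + real z * real (Suc k) * A ^ (z - 1)"
      by (simp add: algebra_simps)
    also have "\<dots> \<le> - (u * (real z * real k * A ^ (z - 1)))
        + real z * real (Suc k) * (1 + real (Suc k) * (1 - u)) ^ (z - 1)"
      unfolding A(2)[symmetric] using A(1) u by (intro add_left_mono mult_left_mono power_mono) auto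
    also have "\<dots> \<le> H' u"
      unfolding H'_def A_def[symmetric] using Bnn[OF u(2)] by simp
    finally show ?thesis .
  qed
  \<comment> \<open>The two indicators overlap at \<open>M\<close> and where the cdf is flat just
    below it, so this is stated as an inequality.\<close>
  have "(\<integral>\<^sup>+y. ennreal (if M \<le> y then real z * B (cdf D y) else B c) \<partial>D)
      \<le> (\<integral>\<^sup>+y. ennreal (real z * B (cdf D y)) * indicator {c..} (cdf D y)
              + ennreal (B c) * indicator {..M} y \<partial>D)"
    by (intro nn_integral_mono)
      (auto simp: c_def cdf_nondecreasing split: split_indicator)
  also have "\<dots> = (\<integral>\<^sup>+y. ennreal (real z * B (cdf D y)) * indicator {c..} (cdf D y) \<partial>D)
      + ennreal (B c) * emeasure D {..M}"
    by (subst nn_integral_add) (auto simp: nn_integral_cmult_indicator)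
  also have "ennreal (B c) * emeasure D {..M} = ennreal (c * B c)"
    using c Bnn[of c]
    by (simp add: emeasure_eq_measure c_def cdf_def2 ennreal_mult'[symmetric] mult.commute)
  also have "(\<integral>\<^sup>+y. ennreal (real z * B (cdf D y)) * indicator {c..} (cdf D y) \<partial>D)
      = (\<integral>\<^sup>+u. ennreal (real z * B u) * indicator {c..} u * indicator {0..1} u \<partial>lborel)"
    by (rule nn_integral_cdf[of "\<lambda>u. ennreal (real z * B u) * indicator {c..} u"]) measurable
  also have "\<dots> \<le> (\<integral>\<^sup>+u. ennreal (H' u) * indicator {c..1} u \<partial>lborel)"
    using zB c by (intro nn_integral_mono) (auto split: split_indicator intro!: ennreal_leI)
  also have "\<dots> = ennreal (H 1 - H c)"
  proof (rule nn_integral_FTC_Icc)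
    show "0 \<le> H' u" if "u \<in> {c..1}" for u
    proof -
      have "0 \<le> real z * B u" using Bnn that by simp
      also have "\<dots> \<le> H' u" using that c by (intro zB) auto
      finally show ?thesis .
    qed
  qed (use H c in \<open>auto intro: DERIV_subset has_field_derivative_at_within\<close>)
  also have "H 1 - H c = (1 + real (Suc k) * (1 - c)) ^ z - c * B c"
    by (simp add: H_def B_def)
  also have "ennreal ((1 + real (Suc k) * (1 - c)) ^ z - c * B c) + ennreal (c * B c)
      = ennreal ((1 + real (Suc k) * (1 - c)) ^ z)"
  proof (subst ennreal_plus[symmetric])
    have "c * B c \<le> 1 * B c" using c Bnn[of c] by (intro mult_right_mono) auto
    also have "1 * B c \<le> (1 + real (Suc k) * (1 - c)) ^ z"
      unfolding B_def mult_1_left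
      using c by (intro power_mono add_left_mono mult_right_mono) auto
    finally show "0 \<le> (1 + real (Suc k) * (1 - c)) ^ z - c * B c" by simp
  qed (use c Bnn[of c] in auto)
  finally have "(\<integral>\<^sup>+y. ennreal (if M \<le> y then real z * B (cdf D y) else B c) \<partial>D)
      \<le> ennreal ((1 + real (Suc k) * (1 - c)) ^ z)"
    by (simp add: add_right_mono)
  then show ?thesis unfolding B_def c_def .
qed

sublocale power: product_sigma_finite "\<lambda>_::nat. D" ..

lemma sets_PiM_D: "sets (\<Pi>\<^sub>M i\<in>I. D) = sets (\<Pi>\<^sub>M i\<in>I. (borel :: real measure))"
  by (intro sets_PiM_cong) auto

text \<open>
  The integrand, as a process in \<open>i\<close>, is a supermartingale: by \<open>record_step\<close> the factor
  \<open>(1 + k q)\<^sup>z\<close>, with \<open>q\<close> the tail probability of the running maximum and \<open>k\<close> the number of values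
  still to come, bounds the generating function at \<open>z\<close> of the number of future records.
\<close>

lemma nn_integral_record_count:
  fixes z :: nat
  assumes z: "1 \<le> z"
  shows "i \<le> n \<Longrightarrow> (\<integral>\<^sup>+x. ennreal (real z ^ record_count t x i *
      (1 + real (n - i) * (1 - cdf D (running_max t x i))) ^ z) \<partial>(\<Pi>\<^sub>M j\<in>{1..i}. D))
    \<le> ennreal ((1 + real n * (1 - cdf D t)) ^ z)"
proof (induction i)
  case 0
  then show ?case by (simp add: PiM_empty nn_integral_count_space_finite)
next
  case (Suc i)
  let ?P = "\<lambda>i. \<Pi>\<^sub>M j\<in>{1..i}. D"
  let ?f = "\<lambda>i x. real z ^ record_count t x i *
      (1 + real (n - i) * (1 - cdf D (running_max t x i))) ^ z"
  define k where "k = n - Suc i"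
  have k: "n - i = Suc k" using Suc.prems by (simp add: k_def)
  have [measurable]: "cdf D \<in> borel_measurable borel"
    using continuous_cdf by (rule borel_measurable_continuous_onI)
  have [measurable]: "(\<lambda>x. record_count t x (Suc i)) \<in> ?P (Suc i) \<rightarrow>\<^sub>M count_space UNIV"
      "(\<lambda>x. running_max t x (Suc i)) \<in> borel_measurable (?P (Suc i))"
    unfolding measurable_cong_sets[OF sets_PiM_D refl]
    by (intro measurable_record_count measurable_running_max order_refl)+
  have meas: "(\<lambda>x. ennreal (?f (Suc i) x)) \<in> borel_measurable (?P (Suc i))"
    by measurable
  have ins: "{1..Suc i} = insert (Suc i) {1..i}" by auto
  \<comment> \<open>The newest value is integrated out first, with the earlier ones fixed, which
    leaves the situation of \<open>record_step\<close>.\<close>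
  have "(\<integral>\<^sup>+x. ennreal (?f (Suc i) x) \<partial>?P (Suc i))
      = (\<integral>\<^sup>+x. \<integral>\<^sup>+y. ennreal (?f (Suc i) (x(Suc i := y))) \<partial>D \<partial>?P i)"
    using meas unfolding ins by (intro power.product_nn_integral_insert) auto
  also have "\<dots> \<le> (\<integral>\<^sup>+x. ennreal (?f i x) \<partial>?P i)"
  proof (rule nn_integral_mono)
    fix x :: "nat \<Rightarrow> real"
    let ?M = "running_max t x i"
    have upd: "running_max t (x(Suc i := y)) i = ?M"
        "record_count t (x(Suc i := y)) i = record_count t x i" for y
      by (auto intro: running_max_cong record_count_cong)
    have "?f (Suc i) (x(Suc i := y)) = real z ^ record_count t x i *
        (if ?M \<le> y then real z * (1 + real k * (1 - cdf D y)) ^ z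
         else (1 + real k * (1 - cdf D ?M)) ^ z)" for y
      by (simp add: record_count_Suc upd k_def max_def)
    then have "(\<integral>\<^sup>+y. ennreal (?f (Suc i) (x(Suc i := y))) \<partial>D)
        = ennreal (real z ^ record_count t x i) *
          (\<integral>\<^sup>+y. ennreal (if ?M \<le> y then real z * (1 + real k * (1 - cdf D y)) ^ z
             else (1 + real k * (1 - cdf D ?M)) ^ z) \<partial>D)"
      by (simp only: ennreal_mult'[OF zero_le_power[OF of_nat_0_le_iff]])
        (subst nn_integral_cmult, auto)
    also have "\<dots> \<le> ennreal (real z ^ record_count t x i) *
        ennreal ((1 + real (Suc k) * (1 - cdf D ?M)) ^ z)"
      by (intro mult_left_mono record_step z) simp
    also have "\<dots> = ennreal (?f i x)"
      unfolding k by (rule ennreal_mult'[symmetric]) simp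
    finally show "(\<integral>\<^sup>+y. ennreal (?f (Suc i) (x(Suc i := y))) \<partial>D) \<le> ennreal (?f i x)" .
  qed
  also have "\<dots> \<le> ennreal ((1 + real n * (1 - cdf D t)) ^ z)"
    using Suc by simp
  finally show ?case .
qed

section \<open>Tail bound and success probability\<close>

lemma prob_record_count_gt:
  fixes z :: nat
  assumes z: "1 \<le> z"
  shows "measure (\<Pi>\<^sub>M j\<in>{1..n}. D) {x \<in> space (\<Pi>\<^sub>M j\<in>{1..n}. D). m < record_count t x n}
    \<le> (1 + real n * (1 - cdf D t)) ^ z / real z ^ m"
proof -
  let ?P = "\<Pi>\<^sub>M j\<in>{1..n}. D"
  interpret P: prob_space ?P
    by (intro prob_space_PiM) (rule prob_space_axioms)
  have [measurable]: "(\<lambda>x. record_count t x n) \<in> ?P \<rightarrow>\<^sub>M count_space UNIV"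
    unfolding measurable_cong_sets[OF sets_PiM_D refl]
    by (intro measurable_record_count order_refl)
  have "emeasure ?P {x \<in> space ?P. m < record_count t x n}
      \<le> emeasure ?P {x \<in> space ?P. 1 \<le> ennreal (1 / real z ^ m) * ennreal (real z ^ record_count t x n)}"
  proof (rule emeasure_mono)
    have "1 \<le> ennreal (1 / real z ^ m) * ennreal (real z ^ r)" if "m < r" for r
    proof -
      have "real z ^ m \<le> real z ^ r"
        using that z by (intro power_increasing) auto
      then have "1 \<le> 1 / real z ^ m * real z ^ r"
        using z by (simp add: field_simps)
      then show ?thesis
        by (simp add: ennreal_mult'[symmetric] ennreal_leI flip: ennreal_1)
    qed
    then show "{x \<in> space ?P. m < record_count t x n} \<subseteq>
      {x \<in> space ?P. 1 \<le> ennreal (1 / real z ^ m) * ennreal (real z ^ record_count t x n)}"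
      by auto
  qed measurable
  also have "\<dots> \<le> ennreal (1 / real z ^ m) *
      (\<integral>\<^sup>+x. ennreal (real z ^ record_count t x n) * indicator (space ?P) x \<partial>?P)"
    by (rule nn_integral_Markov_inequality) measurable
  also have "(\<integral>\<^sup>+x. ennreal (real z ^ record_count t x n) * indicator (space ?P) x \<partial>?P)
      = (\<integral>\<^sup>+x. ennreal (real z ^ record_count t x n) \<partial>?P)"
    by (intro nn_integral_cong) simp
  \<comment> \<open>At \<open>i = n\<close> no value is still to come, so the second factor of the
    integrand is 1.\<close>
  also have "\<dots> \<le> ennreal ((1 + real n * (1 - cdf D t)) ^ z)"
    using nn_integral_record_count[OF z, of n n t] by simp
  also have "ennreal (1 / real z ^ m) * ennreal ((1 + real n * (1 - cdf D t)) ^ z)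
      = ennreal ((1 + real n * (1 - cdf D t)) ^ z / real z ^ m)"
    by (subst ennreal_mult'[symmetric]) auto
  finally have "emeasure ?P {x \<in> space ?P. m < record_count t x n}
      \<le> ennreal ((1 + real n * (1 - cdf D t)) ^ z / real z ^ m)"
    by (simp add: mult_left_mono)
  moreover have "0 \<le> (1 + real n * (1 - cdf D t)) ^ z / real z ^ m"
    using cdf_bounded_prob[of t]
    by (intro divide_nonneg_nonneg zero_le_power add_nonneg_nonneg mult_nonneg_nonneg) auto
  ultimately show ?thesis by (simp only: P.emeasure_eq_measure ennreal_le_iff)
qed

text \<open>Union bound: success, all values at most \<open>t\<close>, and more than
  \<open>m\<close> records cover the whole space.\<close>

lemma success_probability_record_algorithm:
  fixes z :: nat
  assumes z: "1 \<le> z"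
  shows "1 - cdf D t ^ n - (1 + real n * (1 - cdf D t)) ^ z / real z ^ m
    \<le> success_probability D n (record_algorithm m t)"
proof -
  let ?P = "\<Pi>\<^sub>M j\<in>{1..n}. D"
  interpret F: finite_product_prob_space "\<lambda>_::nat. D" "{1..n}"
    by standard auto
  define S where "S = {x \<in> space ?P. selects_max n (record_algorithm m t) x}"
  define E where "E = (\<Pi>\<^sub>E j\<in>{1..n}. {..t})"
  define R where "R = {x \<in> space ?P. m < record_count t x n}"
  have "Measurable.pred ?P (selects_max n (record_algorithm m t))"
    unfolding measurable_cong_sets[OF sets_PiM_D refl]
    using record_algorithm_with_calls[of m n t]
    by (intro measurable_selects_max) (simp add: algorithm_with_calls_def)
  then have S: "S \<in> sets ?P" unfolding S_def by (simp add: pred_def)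
  have E: "E \<in> sets ?P" unfolding E_def by (intro sets_PiM_I_finite) auto
  have [measurable]: "(\<lambda>x. record_count t x n) \<in> ?P \<rightarrow>\<^sub>M count_space UNIV"
    unfolding measurable_cong_sets[OF sets_PiM_D refl]
    by (intro measurable_record_count order_refl)
  have R: "R \<in> sets ?P" unfolding R_def by measurable
  have "space ?P \<subseteq> S \<union> E \<union> R"
  proof
    fix x assume x: "x \<in> space ?P"
    show "x \<in> S \<union> E \<union> R"
    proof (cases "x \<in> E \<union> R")
      case False
      then obtain i where "i \<in> {1..n}" "t \<le> x i"
        using x by (fastforce simp: E_def space_PiM PiE_iff)
      then show ?thesis
        using False x record_algorithm_selects_max[of i n t x m] by (auto simp: S_def R_def)
    qed auto
  qed
  then have "1 \<le> measure ?P (S \<union> E \<union> R)"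
    using S E R F.finite_measure_mono[of "space ?P" "S \<union> E \<union> R"] F.P.prob_space by simp
  also have "\<dots> \<le> measure ?P (S \<union> E) + measure ?P R"
    using S E R by (intro measure_Un_le) auto
  also have "measure ?P (S \<union> E) \<le> measure ?P S + measure ?P E"
    using S E by (intro measure_Un_le) auto
  also have "measure ?P E = cdf D t ^ n"
    unfolding E_def by (subst F.prob_times) (auto simp: cdf_def)
  also have "measure ?P R \<le> (1 + real n * (1 - cdf D t)) ^ z / real z ^ m"
    unfolding R_def by (rule prob_record_count_gt[OF z])
  finally show ?thesis
    by (simp add: success_probability_def S_def)
qed

end

section \<open>Asymptotics and choice of parameters\<close>

text \<open>
  With \<open>z = \<lfloor>\<surd>m\<rfloor>\<close> the denominator \<open>z\<^sup>m\<close> is about \<open>m powr (m / 2)\<close>, and the numerator is only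
  \<open>exp (O(\<surd>m ln m))\<close>.
\<close>

lemma eventually_record_bound:
  "eventually (\<lambda>m. (1 + real m / 5 * ln (real m)) ^ nat \<lfloor>sqrt (real m)\<rfloor> /
      real (nat \<lfloor>sqrt (real m)\<rfloor>) ^ m \<le> real m powr (- real m / 5)) sequentially"
proof -
  \<comment> \<open>Logarithm of the claim with the floor removed: \<open>z\<close> lies between
    \<open>sqrt m - 1\<close> and \<open>sqrt m\<close>, and each term takes the worse end.\<close>
  have "eventually (\<lambda>m. sqrt (real m) * ln (1 + real m / 5 * ln (real m))
      - real m * ln (sqrt (real m) - 1) \<le> - real m / 5 * ln (real m)) sequentially"
    by real_asymp
  moreover have "eventually (\<lambda>m::nat. 4 < m) sequentially"
    by (rule eventually_gt_at_top)
  ultimately show ?thesis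
  proof eventually_elim
    case (elim m)
    define z where "z = nat \<lfloor>sqrt (real m)\<rfloor>"
    have "sqrt 4 < sqrt (real m)" using elim by (subst real_sqrt_less_iff) simp
    then have s: "2 < sqrt (real m)" by simp
    have z: "sqrt (real m) - 1 < real z" "real z \<le> sqrt (real m)"
      using s unfolding z_def by linarith+
    define L where "L = 1 + real m / 5 * ln (real m)"
    have L: "1 \<le> L" using elim by (simp add: L_def)
    have "L ^ z / real z ^ m = exp (real z * ln L - real m * ln (real z))"
      using L z s by (simp add: exp_diff exp_of_nat_mult)
    also have "\<dots> \<le> exp (- real m / 5 * ln (real m))"
    proof -
      have "real z * ln L \<le> sqrt (real m) * ln L"
        using z L by (intro mult_right_mono) auto
      moreover have "real m * ln (sqrt (real m) - 1) \<le> real m * ln (real z)"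
        using z s by (intro mult_left_mono iffD2[OF ln_le_cancel_iff]) linarith+
      ultimately have "real z * ln L - real m * ln (real z) \<le> - real m / 5 * ln (real m)"
        using elim(1) unfolding L_def[symmetric] by linarith
      then show ?thesis by simp
    qed
    also have "\<dots> = real m powr (- real m / 5)"
      using elim by (simp add: powr_def)
    finally show ?case by (simp add: L_def z_def)
  qed
qed

theorem theorem4p2:
  shows "\<exists>C::real. C > 0 \<and> (\<exists>m0::nat. \<forall>m\<ge>m0. \<exists>n0::nat. \<forall>n\<ge>n0.
           \<forall>D. continuous_distribution D \<longrightarrow>
             (\<exists>A. algorithm_with_calls m n A \<and>
                  success_probability D n A \<ge> 1 - C * real m powr (- real m / 5)))"
proof -
  obtain m1 where m1: "\<And>m. m1 \<le> m \<Longrightarrow> (1 + real m / 5 * ln (real m)) ^ nat \<lfloor>sqrt (real m)\<rfloor> /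
      real (nat \<lfloor>sqrt (real m)\<rfloor>) ^ m \<le> real m powr (- real m / 5)"
    using eventually_record_bound unfolding eventually_sequentially by blast
  \<comment> \<open>The constant 2 pays for the two failure events. \<open>m \<ge> 2\<close> makes
    \<open>L\<close> positive and the bound on \<open>n\<close> gives \<open>L < n\<close>, so the
    level \<open>1 - L / n\<close> is attained. Only \<open>t\<close> depends on
    \<open>D\<close>.\<close>
  have "\<exists>A. algorithm_with_calls m n A \<and>
      success_probability D n A \<ge> 1 - 2 * real m powr (- real m / 5)"
    if m: "max 2 m1 \<le> m" and n: "nat \<lceil>real m / 5 * ln (real m)\<rceil> + 1 \<le> n"
      and D: "continuous_distribution D" for m n D
  proof -
    interpret real_distribution D
      using D by (simp add: continuous_distribution_def)
    interpret continuous_real_distribution D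
      using D by unfold_locales (simp add: continuous_distribution_def)
    define L where "L = real m / 5 * ln (real m)"
    have "0 < L" using m by (simp add: L_def)
    have "L < real n" using n unfolding L_def by linarith
    obtain t where t: "cdf D t = 1 - L / real n"
      using cdf_attains[of "1 - L / real n"] \<open>0 < L\<close> \<open>L < real n\<close> by (auto simp: field_simps)
    define z where "z = nat \<lfloor>sqrt (real m)\<rfloor>"
    have "1 \<le> sqrt (real m)" using m by simp
    then have z: "1 \<le> z" unfolding z_def by linarith
    \<comment> \<open>\<open>L\<close> is chosen so that \<open>exp (- L)\<close> is exactly the
      target error.\<close>
    have "cdf D t ^ n \<le> exp (- L / real n) ^ n"
      using t cdf_nonneg[of t] exp_ge_add_one_self[of "- L / real n"] by (intro power_mono) auto
    also have "\<dots> = exp (- L)"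
      using \<open>0 < L\<close> \<open>L < real n\<close> by (simp flip: exp_of_nat_mult)
    also have "\<dots> = real m powr (- real m / 5)"
      using m by (simp add: L_def powr_def)
    finally have "cdf D t ^ n \<le> real m powr (- real m / 5)" .
    moreover have "(1 + real n * (1 - cdf D t)) ^ z / real z ^ m \<le> real m powr (- real m / 5)"
    proof -
      have "real n * (1 - cdf D t) = L"
        using t \<open>0 < L\<close> \<open>L < real n\<close> by simp
      then show ?thesis using m1[of m] m by (simp only: z_def L_def max.bounded_iff)
    qed
    ultimately have "1 - 2 * real m powr (- real m / 5)
        \<le> success_probability D n (record_algorithm m t)"
      using success_probability_record_algorithm[OF z, of t n m] by linarith
    then show ?thesis
      using record_algorithm_with_calls by blast
  qed
  then show ?thesis
    by (intro exI[of _ 2] conjI exI[of _ "max 2 m1" for m1] allI impI) auto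
qed

end
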